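(* Every permutation in the symmetric group $S_n$ has a unique reduced expression $s_{i_1}\circ\cdots\circ s_{i_k}$ with all of the following properties: (1) $s_i$ is never immediately followed by $s_j$ for any $j>i+1$; (2) no three consecutive factors are $s_{i+1}\circ s_i\circ s_{i+1}$ for any $i$; (3) no reduced expression in the commutation class of $s_{i_1}\circ\cdots\circ s_{i_k}$ contains three consecutive factors $s_{i+1}\circ s_i\circ s_{i+1}$.
   Context: $s_i$ denotes the adjacent transposition $(i,i+1)$, $1\le i\le n-1$. A reduced expression for a permutation is an expression as a product of adjacent transpositions of minimal possible length. The commutation class of a reduced expression is the set of reduced expressions obtainable from it by repeatedly applying commutation relations $s_i\circ s_j=s_j\circ s_i$ with $|i-j|>1$ to consecutive factors. *)

theory Defs
  imports "HOL-Combinatorics.Permutations" "HOL-Library.Sublist"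
begin

definition adj_transp :: "nat \<Rightarrow> nat \<Rightarrow> nat" where
  "adj_transp i = Transposition.transpose i (i + 1)"

text \<open>An expression is encoded by its list of indices, in written order: the list
  \<open>[i\<^sub>1, \<dots>, i\<^sub>k]\<close> stands for \<open>s\<^sub>i\<^sub>1 \<circ> \<dots> \<circ> s\<^sub>i\<^sub>k\<close>.
  Consecutive factors are thus contiguous segments, i.e. \<^const>\<open>sublist\<close> (not \<^const>\<open>subseq\<close>).\<close>

definition word_perm :: "nat list \<Rightarrow> nat \<Rightarrow> nat" where
  "word_perm w = foldr (\<circ>) (map adj_transp w) id"

definition expression :: "nat \<Rightarrow> (nat \<Rightarrow> nat) \<Rightarrow> nat list \<Rightarrow> bool" where
  "expression n p w \<longleftrightarrow> set w \<subseteq> {1..<n} \<and> word_perm w = p"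

definition reduced_expression :: "nat \<Rightarrow> (nat \<Rightarrow> nat) \<Rightarrow> nat list \<Rightarrow> bool" where
  "reduced_expression n p w \<longleftrightarrow>
     expression n p w \<and> (\<forall>v. expression n p v \<longrightarrow> length w \<le> length v)"

inductive commutation :: "nat list \<Rightarrow> nat list \<Rightarrow> bool" where
  "\<bar>int i - int j\<bar> > 1 \<Longrightarrow> commutation (u @ [i, j] @ v) (u @ [j, i] @ v)"

definition commutation_class :: "nat \<Rightarrow> nat list \<Rightarrow> nat list set" where
  "commutation_class n w =
     {v. (\<exists>p. reduced_expression n p v) \<and> commutation\<^sup>*\<^sup>* w v}"

end

theory Submission
  imports Defs
begin

text \<open>Conditions (1) and (3) force a word on the letters below \<open>Suc n\<close> to be a run
  \<open>k, k + 1, \<dots>, n\<close> followed by a word of the same kind on the letters below \<open>n\<close>, where \<open>k\<close>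
  is the image of \<open>Suc n\<close>; this gives uniqueness by induction. The key is that two
  occurrences of \<open>i\<close> must have an \<open>i + 1\<close> between them: otherwise, taking them
  consecutive, they enclose at least two letters \<open>i - 1\<close> with no \<open>i\<close> between these, and one descends to the letter \<open>0\<close>.
  For existence, among the reduced words pick one that first minimizes the sum of its letters (which
  rules out braids \<open>i + 1, i, i + 1\<close> throughout its commutation class) and then
  minimizes the position-weighted sum of its letters.\<close>

section \<open>Words and the permutations they express\<close>

lemma word_perm_Nil [simp]: "word_perm [] = id"
  by (simp add: word_perm_def)

lemma word_perm_Cons [simp]: "word_perm (i # w) = adj_transp i \<circ> word_perm w"
  by (simp add: word_perm_def)

lemma word_perm_append [simp]: "word_perm (u @ v) = word_perm u \<circ> word_perm v"
  by (induction u) (simp_all add: comp_assoc)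

lemma adj_transp_involutory [simp]: "adj_transp i \<circ> adj_transp i = id"
  by (simp add: adj_transp_def)

lemma adj_transp_commute:
  assumes "\<bar>int i - int j\<bar> > 1"
  shows "adj_transp i \<circ> adj_transp j = adj_transp j \<circ> adj_transp i"
  using assms by (auto simp: adj_transp_def transpose_def fun_eq_iff)

lemma adj_transp_braid:
  "adj_transp (Suc i) \<circ> adj_transp i \<circ> adj_transp (Suc i)
    = adj_transp i \<circ> adj_transp (Suc i) \<circ> adj_transp i"
  by (auto simp: adj_transp_def transpose_def fun_eq_iff)

lemma word_perm_rev: "word_perm (rev w) \<circ> word_perm w = id"
proof (induction w)
  case (Cons i w)
  have "word_perm (rev (i # w)) \<circ> word_perm (i # w)
      = word_perm (rev w) \<circ> (adj_transp i \<circ> adj_transp i) \<circ> word_perm w"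
    by (simp only: rev.simps word_perm_append word_perm_Cons word_perm_Nil comp_id comp_assoc)
  also have "\<dots> = id"
    by (simp only: adj_transp_involutory comp_id Cons.IH)
  finally show ?case .
qed simp

lemma word_perm_permutes: "set w \<subseteq> {1..<n} \<Longrightarrow> word_perm w permutes {1..n}"
proof (induction w)
  case (Cons i w)
  have "adj_transp i permutes {1..n}"
    unfolding adj_transp_def using Cons.prems by (intro permutes_swap_id) auto
  moreover have "word_perm w permutes {1..n}"
    using Cons by simp
  ultimately show ?case
    unfolding word_perm_Cons by (intro permutes_compose)
qed (simp add: permutes_id)

text \<open>The rightmost factor acts first, so each letter of the run lowers the image of
  \<open>m\<close> by one until it reaches \<open>k\<close>.\<close>

lemma word_perm_upt: "k \<le> m \<Longrightarrow> word_perm [k..<m] m = k"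
proof (induction k rule: inc_induct)
  case (step k)
  then show ?case by (simp add: upt_conv_Cons adj_transp_def)
qed simp

text \<open>Choosing \<open>k = p (Suc n)\<close>, the run \<open>[k..<Suc n]\<close> agrees with
  \<open>p\<close> at \<open>Suc n\<close>. Undoing it leaves a permutation that fixes
  \<open>Suc n\<close>, to which induction applies.\<close>

lemma ex_expression:
  assumes "p permutes {1..n}"
  shows "\<exists>w. expression n p w"
  using assms
proof (induction n arbitrary: p)
  case 0
  then show ?case by (auto simp: expression_def intro: exI[of _ "[]"])
next
  case (Suc n)
  define k where "k = p (Suc n)"
  have k: "k \<in> {1..Suc n}"
    unfolding k_def using permutes_in_image[OF Suc.prems, of "Suc n"] by simp
  define c where "c = [k..<Suc n]"
  have c: "set c \<subseteq> {1..<Suc n}"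
    using k by (auto simp: c_def)
  have ck: "word_perm c (Suc n) = k"
    unfolding c_def using k by (intro word_perm_upt) simp
  define q where "q = word_perm (rev c) \<circ> p"
  have "q permutes {1..Suc n}"
    unfolding q_def using c Suc.prems by (intro permutes_compose word_perm_permutes) auto
  moreover have "q (Suc n) = Suc n"
    using fun_cong[OF word_perm_rev[of c], of "Suc n"] ck by (simp add: q_def k_def)
  ultimately have "q permutes {1..n}"
    by (elim permutes_superset) (auto simp: le_Suc_eq)
  then obtain w where w: "set w \<subseteq> {1..<n}" "word_perm w = q"
    using Suc.IH by (auto simp: expression_def)
  have "word_perm (c @ w) = p"
    using word_perm_rev[of "rev c"] w(2) by (simp add: q_def comp_assoc[symmetric])
  moreover have "set (c @ w) \<subseteq> {1..<Suc n}"
    using c w(1) by auto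
  ultimately show ?case unfolding expression_def by blast
qed

section \<open>Commutation moves and reducedness\<close>

lemma commutation_same:
  assumes "commutation\<^sup>*\<^sup>* w v"
  shows "word_perm v = word_perm w" "mset v = mset w"
proof -
  have "word_perm v = word_perm w \<and> mset v = mset w"
    using assms
  proof induction
    case (step y z)
    from step.hyps(2) show ?case
    proof cases
      case (1 i j u v)
      have "word_perm z = word_perm u \<circ> (adj_transp j \<circ> adj_transp i) \<circ> word_perm v"
        by (simp add: 1 comp_assoc)
      also have "\<dots> = word_perm y"
        unfolding adj_transp_commute[OF 1(3), symmetric] by (simp add: 1 comp_assoc)
      finally have "word_perm z = word_perm y" .
      moreover have "mset z = mset y" by (simp add: 1)
      ultimately show ?thesis using step.IH by metis
    qed
  qed simp
  then show "word_perm v = word_perm w" "mset v = mset w" by auto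
qed

lemma reduced_expression_commutation:
  assumes "reduced_expression n p w" "commutation\<^sup>*\<^sup>* w v"
  shows "reduced_expression n p v"
  using assms(1) commutation_same[OF assms(2)] mset_eq_setD[of v w] mset_eq_length[of v w]
  by (auto simp: reduced_expression_def expression_def)

lemma commutation_move_right:
  assumes "\<forall>y\<in>set x. \<bar>int i - int y\<bar> > 1"
  shows "commutation\<^sup>*\<^sup>* (u @ i # x @ v) (u @ x @ i # v)"
  using assms
proof (induction x arbitrary: u)
  case (Cons y x)
  have "commutation (u @ i # (y # x) @ v) ((u @ [y]) @ i # x @ v)"
    using commutation.intros[of i y u "x @ v"] Cons.prems by simp
  moreover have "commutation\<^sup>*\<^sup>* ((u @ [y]) @ i # x @ v) ((u @ [y]) @ x @ i # v)"
    by (rule Cons.IH) (use Cons.prems in simp)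
  ultimately have "commutation\<^sup>*\<^sup>* (u @ i # (y # x) @ v) ((u @ [y]) @ x @ i # v)"
    by (rule converse_rtranclp_into_rtranclp)
  then show ?case by simp
qed simp

lemma commutation_move_left:
  assumes "\<forall>y\<in>set x. \<bar>int i - int y\<bar> > 1"
  shows "commutation\<^sup>*\<^sup>* (u @ x @ i # v) (u @ i # x @ v)"
proof -
  have "symp commutation"
  proof (rule sympI)
    show "commutation b a" if "commutation a b" for a b
      using that
    proof cases
      case (1 i j u v)
      then show ?thesis using commutation.intros[of j i u v] by (simp add: abs_minus_commute)
    qed
  qed
  then have "symp commutation\<^sup>*\<^sup>*"
    by (rule symp_rtranclp)
  then show ?thesis
    using commutation_move_right[OF assms] by (blast dest: sympD)
qed

text \<open>Cancelling the pair would leave a shorter expression.\<close>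

lemma reduced_expression_no_repeat:
  assumes "reduced_expression n p w"
  shows "w \<noteq> u @ [i, i] @ v"
proof
  assume w: "w = u @ [i, i] @ v"
  have "word_perm w = word_perm u \<circ> (adj_transp i \<circ> adj_transp i) \<circ> word_perm v"
    by (simp only: w word_perm_append word_perm_Cons word_perm_Nil comp_id comp_assoc)
  then have "word_perm (u @ v) = word_perm w" by simp
  then have "expression n p (u @ v)"
    using assms w by (auto simp: reduced_expression_def expression_def)
  then have "length w \<le> length (u @ v)"
    using assms by (auto simp: reduced_expression_def)
  then show False using w by simp
qed

section \<open>Separation of equal letters\<close>

text \<open>\<open>x\<close> may itself contain \<open>i\<close>, so every pair of occurrences is
  covered. In particular the largest letter of such a word occurs only once.\<close>

definition separated :: "nat list \<Rightarrow> bool" where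
  "separated w \<longleftrightarrow> (\<forall>u i x v. w = u @ i # x @ i # v \<longrightarrow> Suc i \<in> set x)"

lemma separated_append_right:
  assumes "separated (u @ w)"
  shows "separated w"
  unfolding separated_def
proof (intro allI impI)
  fix s i x t
  assume "w = s @ i # x @ i # t"
  then have "u @ w = (u @ s) @ i # x @ i # t" by simp
  then show "Suc i \<in> set x" using assms unfolding separated_def by blast
qed

text \<open>Induction on the letter. Between neighbouring copies of \<open>Suc k\<close> without
  \<open>Suc (Suc k)\<close>, no \<open>k\<close> would let the copies meet and cancel, exactly one
  \<open>k\<close> would let them close in to a forbidden braid, and two \<open>k\<close>'s
  contradict the induction hypothesis.\<close>

lemma reduced_expression_separated:
  assumes red: "reduced_expression n p w"
    and braid: "\<forall>v\<in>commutation_class n w. \<forall>i. \<not> sublist [i + 1, i, i + 1] v"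
  shows "separated w"
proof -
  have in_class: "v \<in> commutation_class n w" if "commutation\<^sup>*\<^sup>* w v" for v
    using that reduced_expression_commutation[OF red] by (auto simp: commutation_class_def)
  have "Suc i \<in> set x" if "w = u @ i # x @ i # v" for u i x v
    using that
  proof (induction i arbitrary: u x v)
    case 0
    \<comment> \<open>All letters are positive, so 0 does not occur.\<close>
    then show ?case using red by (auto simp: reduced_expression_def expression_def)
  next
    case (Suc k)
    show ?case
    proof (rule ccontr)
      assume no: "Suc (Suc k) \<notin> set x"
      \<comment> \<open>\<open>y\<close> is the part of \<open>x\<close> before the next
        \<open>Suc k\<close>, or all of \<open>x\<close> if there is none.\<close>
      obtain y z where w: "w = u @ Suc k # y @ Suc k # z" and y: "Suc k \<notin> set y" "Suc (Suc k) \<notin> set y"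
      proof (cases "Suc k \<in> set x")
        case True
        then obtain x1 x2 where "x = x1 @ Suc k # x2" "Suc k \<notin> set x1"
          by (meson split_list_first)
        then show thesis using that[of x1 "x2 @ Suc k # v"] Suc.prems no by auto
      next
        case False
        then show thesis using that Suc.prems no by blast
      qed
      \<comment> \<open>Among the letters of \<open>y\<close>, only \<open>k\<close> fails to
        commute with \<open>Suc k\<close>.\<close>
      have far: "\<forall>j\<in>set a. \<bar>int (Suc k) - int j\<bar> > 1" if "set a \<subseteq> set y" "k \<notin> set a" for a
      proof
        fix j assume "j \<in> set a"
        then have "j \<noteq> k" "j \<noteq> Suc k" "j \<noteq> Suc (Suc k)" using that y by auto
        then show "\<bar>int (Suc k) - int j\<bar> > 1" by linarith
      qed
      show False
      proof (cases "k \<in> set y")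
        case False
        then have "commutation\<^sup>*\<^sup>* w (u @ y @ [Suc k, Suc k] @ z)"
          using commutation_move_right[OF far[of y], of u "Suc k # z"] w by simp
        then have "reduced_expression n p ((u @ y) @ [Suc k, Suc k] @ z)"
          using reduced_expression_commutation[OF red] by simp
        then show False using reduced_expression_no_repeat by blast
      next
        case True
        then obtain a b where ab: "y = a @ k # b" "k \<notin> set a"
          by (meson split_list_first)
        show False
        proof (cases "k \<in> set b")
          case True
          then obtain c d where cd: "b = c @ k # d"
            by (meson split_list)
          have "w = (u @ Suc k # a) @ k # c @ k # (d @ Suc k # z)"
            using w ab cd by simp
          then have "Suc k \<in> set c" by (rule Suc.IH)
          then show False using y ab cd by auto
        next
          case False
          \<comment> \<open>Both \<open>a\<close> and \<open>b\<close> are free of \<open>k\<close>: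
            the left copy moves right past \<open>a\<close>, the right copy moves left past
            \<open>b\<close>.\<close>
          have "commutation\<^sup>*\<^sup>* w (u @ a @ Suc k # k # b @ Suc k # z)"
            using commutation_move_right[OF far[of a], of u "k # b @ Suc k # z"] w ab by auto
          also have "commutation\<^sup>*\<^sup>* \<dots> ((u @ a) @ [Suc k, k, Suc k] @ b @ z)"
            using commutation_move_left[OF far[of b], of "u @ a @ [Suc k, k]" z] ab False by auto
          finally show False
            using braid in_class by (metis Suc_eq_plus1 sublist_appendI)
        qed
      qed
    qed
  qed
  then show ?thesis by (auto simp: separated_def)
qed

section \<open>Splitting off the top run, and uniqueness\<close>

text \<open>The run absorbs \<open>a\<close> from the right. For the letter \<open>x\<close> just
  before \<open>k\<close>, the ban on jumps gives \<open>k \<le> Suc x\<close>, while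
  \<open>k \<le> x\<close> would put a second \<open>x\<close> into the run with only smaller
  letters in between. Hence \<open>k = Suc x\<close>.\<close>

lemma separated_run_extend:
  assumes "separated (a @ [k..<Suc m] @ b)" "k \<le> m"
    and "\<forall>i j. j > i + 1 \<longrightarrow> \<not> sublist [i, j] (a @ [k..<Suc m] @ b)"
    and "\<forall>x\<in>set a. x \<le> m"
  shows "\<exists>l\<le>m. a @ [k..<Suc m] @ b = [l..<Suc m] @ b"
  using assms
proof (induction a arbitrary: k rule: rev_induct)
  case Nil
  then show ?case by auto
next
  case (snoc x a)
  have "(a @ [x]) @ [k..<Suc m] @ b = a @ [x, k] @ [Suc k..<Suc m] @ b"
    using \<open>k \<le> m\<close> by (simp add: upt_conv_Cons del: upt_Suc)
  then have "sublist [x, k] ((a @ [x]) @ [k..<Suc m] @ b)"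
    by (metis sublist_appendI)
  then have kx: "k \<le> Suc x" using snoc.prems(3) by (metis Suc_eq_plus1 not_le)
  have "\<not> k \<le> x"
  proof
    assume "k \<le> x"
    then have "[k..<Suc m] = [k..<x] @ [x..<Suc m]"
      using snoc.prems(4) \<open>k \<le> x\<close> upt_add_eq_append[of k x "Suc m - x"] by auto
    also have "[x..<Suc m] = x # [Suc x..<Suc m]"
      using snoc.prems(4) by (intro upt_conv_Cons) auto
    finally have "(a @ [x]) @ [k..<Suc m] @ b = a @ x # [k..<x] @ x # [Suc x..<Suc m] @ b"
      by simp
    then have "Suc x \<in> set [k..<x]"
      using snoc.prems(1) unfolding separated_def by blast
    then show False by simp
  qed
  with kx have "k = Suc x" by simp
  then have "(a @ [x]) @ [k..<Suc m] @ b = a @ [x..<Suc m] @ b"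
    using \<open>k \<le> m\<close> by (simp add: upt_conv_Cons del: upt_Suc)
  note eq = this
  have "\<exists>l\<le>m. a @ [x..<Suc m] @ b = [l..<Suc m] @ b"
    by (rule snoc.IH) (use snoc.prems[unfolded eq] snoc.prems(4) in auto)
  then show ?case unfolding eq .
qed

lemma separated_decompose:
  assumes sep: "separated w"
    and asc: "\<forall>i j. j > i + 1 \<longrightarrow> \<not> sublist [i, j] w"
    and set: "set w \<subseteq> {1..<Suc n}"
  shows "\<exists>k b. k \<le> Suc n \<and> w = [k..<Suc n] @ b \<and> set b \<subseteq> {1..<n}"
proof (cases "n \<in> set w")
  case False
  then have "set w \<subseteq> {1..<n}" using set by (force simp: less_Suc_eq)
  \<comment> \<open>The value \<open>Suc n\<close> for \<open>k\<close> makes the run empty.\<close>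
  then show ?thesis by (intro exI[of _ "Suc n"] exI[of _ w]) simp
next
  case True
  then obtain a b where w: "w = a @ n # b" by (meson split_list)
  have nb: "n \<notin> set b"
  proof
    assume "n \<in> set b"
    then obtain c d where "b = c @ n # d" by (meson split_list)
    \<comment> \<open>A second \<open>n\<close> would require the letter \<open>Suc n\<close>, which
      is out of range.\<close>
    then show False using sep set w unfolding separated_def by fastforce
  qed
  have eq: "w = a @ [n..<Suc n] @ b" using w by simp
  have "\<exists>k\<le>n. a @ [n..<Suc n] @ b = [k..<Suc n] @ b"
    by (rule separated_run_extend) (use sep asc set in \<open>auto simp: eq\<close>)
  moreover have "set b \<subseteq> {1..<n}" using set w nb by (force simp: less_Suc_eq)
  ultimately show ?thesis unfolding eq by (metis le_SucI)
qed

lemma separated_word_perm_inj: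
  assumes "separated w" "\<forall>i j. j > i + 1 \<longrightarrow> \<not> sublist [i, j] w" "set w \<subseteq> {1..<n}"
    and "separated v" "\<forall>i j. j > i + 1 \<longrightarrow> \<not> sublist [i, j] v" "set v \<subseteq> {1..<n}"
    and "word_perm w = word_perm v"
  shows "w = v"
  using assms
proof (induction n arbitrary: w v)
  case 0
  then show ?case by simp
next
  case (Suc n)
  obtain k b where w: "k \<le> Suc n" "w = [k..<Suc n] @ b" "set b \<subseteq> {1..<n}"
    using separated_decompose Suc.prems(1-3) by blast
  obtain l c where v: "l \<le> Suc n" "v = [l..<Suc n] @ c" "set c \<subseteq> {1..<n}"
    using separated_decompose Suc.prems(4-6) by blast
  \<comment> \<open>The tail \<open>d\<close> fixes \<open>Suc n\<close>, so the start of the run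
    can be read off from the permutation.\<close>
  have top: "word_perm ([i..<Suc n] @ d) (Suc n) = i" if "i \<le> Suc n" "set d \<subseteq> {1..<n}" for i d
  proof -
    have "word_perm d (Suc n) = Suc n"
      using permutes_not_in[OF word_perm_permutes[OF that(2)]] by simp
    then show ?thesis using word_perm_upt[OF that(1)] by (simp del: upt_Suc)
  qed
  have "k = l" using top w v Suc.prems(7) by metis
  have "word_perm b = word_perm c"
  proof -
    have "word_perm (rev [k..<Suc n]) \<circ> word_perm w = word_perm b"
      unfolding w(2) word_perm_append comp_assoc[symmetric] word_perm_rev by (rule id_comp)
    moreover have "word_perm (rev [k..<Suc n]) \<circ> word_perm v = word_perm c"
      unfolding v(2) \<open>k = l\<close> word_perm_append comp_assoc[symmetric] word_perm_rev by (rule id_comp)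
    ultimately show ?thesis using Suc.prems(7) by simp
  qed
  moreover have sublist: "sublist s ([k..<Suc n] @ d)" if "sublist s d" for s d
    using that by (auto simp: sublist_append simp del: upt_Suc)
  have "\<forall>i j. j > i + 1 \<longrightarrow> \<not> sublist [i, j] b"
    using Suc.prems(2) sublist unfolding w(2) by blast
  moreover have "\<forall>i j. j > i + 1 \<longrightarrow> \<not> sublist [i, j] c"
    using Suc.prems(5) sublist unfolding v(2) \<open>k = l\<close> by blast
  moreover have "separated b" "separated c"
    using Suc.prems(1,4) unfolding w(2) v(2) by (auto dest: separated_append_right)
  ultimately have "b = c"
    using Suc.IH[of b c] w(3) v(3) by blast
  then show ?case unfolding w(2) v(2) \<open>k = l\<close> by simp
qed

section \<open>Existence by minimization\<close>

text \<open>The letter at position \<open>t\<close>, counted from 1, lies in \<open>t\<close>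
  suffixes and so counts \<open>t\<close> times. Moving the larger letter forward lowers the total
  by \<open>j - i\<close>.\<close>

lemma sum_suffixes_swap:
  fixes i j :: nat
  assumes "i < j"
  shows "sum_list (map sum_list (suffixes (u @ [j, i] @ v)))
    < sum_list (map sum_list (suffixes (u @ [i, j] @ v)))"
  using assms by (induction u) auto

lemma ex_normal_reduced_expression:
  assumes "p permutes {1..n}"
  shows "\<exists>w. reduced_expression n p w
    \<and> (\<forall>i j. j > i + 1 \<longrightarrow> \<not> sublist [i, j] w)
    \<and> (\<forall>v \<in> commutation_class n w. \<forall>i. \<not> sublist [i + 1, i, i + 1] v)"
proof -
  define weight where "weight = (\<lambda>w :: nat list. sum_list (map sum_list (suffixes w)))"
  obtain w0 where "expression n p w0" using ex_expression[OF assms] by blast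
  then have "\<exists>w. reduced_expression n p w"
    using ex_has_least_nat[of "expression n p" w0 length] by (auto simp: reduced_expression_def)
  \<comment> \<open>The order is lexicographic with the letter sum first: that sum is constant on a
    commutation class, whereas the weight is not.\<close>
  then obtain w where red: "reduced_expression n p w"
    and min: "\<And>v. (v, w) \<in> measures [sum_list, weight] \<Longrightarrow> \<not> reduced_expression n p v"
    using wfE_min[OF wf_measures[of "[sum_list, weight]"], of _ "Collect (reduced_expression n p)"]
    by (metis mem_Collect_eq)
  have "\<not> sublist [i, j] w" if "j > i + 1" for i j
  proof
    assume "sublist [i, j] w"
    then obtain u v where w: "w = u @ [i, j] @ v" by (auto simp: sublist_def)
    have "commutation w (u @ [j, i] @ v)"
      unfolding w using that by (intro commutation.intros) simp
    then have "reduced_expression n p (u @ [j, i] @ v)"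
      using reduced_expression_commutation[OF red] by blast
    moreover have "weight (u @ [j, i] @ v) < weight w"
      unfolding weight_def w using that by (intro sum_suffixes_swap) simp
    \<comment> \<open>The letter sums agree, so the weight decides.\<close>
    ultimately show False using min[of "u @ [j, i] @ v"] by (simp add: w)
  qed
  moreover have "\<not> sublist [i + 1, i, i + 1] v" if "v \<in> commutation_class n w" for v i
  proof
    assume "sublist [i + 1, i, i + 1] v"
    then obtain x y where v: "v = x @ [Suc i, i, Suc i] @ y" by (auto simp: sublist_def)
    have wv: "commutation\<^sup>*\<^sup>* w v" using that by (simp add: commutation_class_def)
    then have redv: "reduced_expression n p v"
      using reduced_expression_commutation[OF red] by blast
    define v' where "v' = x @ [i, Suc i, i] @ y"
    have "word_perm v = word_perm x \<circ> (adj_transp (Suc i) \<circ> adj_transp i \<circ> adj_transp (Suc i)) \<circ> word_perm y"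
      by (simp add: v comp_assoc)
    also have "\<dots> = word_perm v'"
      unfolding adj_transp_braid by (simp add: v'_def comp_assoc)
    finally have "reduced_expression n p v'"
      using redv by (auto simp: reduced_expression_def expression_def v v'_def)
    \<comment> \<open>The braid move lowers the letter sum by one. As \<open>v\<close> is a
      rearrangement of \<open>w\<close>, this already contradicts the minimality of
      \<open>w\<close>.\<close>
    moreover have "sum_list v' < sum_list v" by (simp add: v v'_def)
    then have "sum_list v' < sum_list w"
      using commutation_same(2)[OF wv] by (metis sum_mset_sum_list)
    ultimately show False using min[of v'] by simp
  qed
  ultimately show ?thesis using red by blast
qed

theorem theorem5p2:
  fixes n :: nat and p :: "nat \<Rightarrow> nat"
  assumes "p permutes {1..n}"
  shows "\<exists>!w. reduced_expression n p w
    \<and> (\<forall>i j. j > i + 1 \<longrightarrow> \<not> sublist [i, j] w)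
    \<and> (\<forall>i. \<not> sublist [i + 1, i, i + 1] w)
    \<and> (\<forall>v \<in> commutation_class n w. \<forall>i. \<not> sublist [i + 1, i, i + 1] v)"
proof -
  obtain w where w: "reduced_expression n p w" "\<forall>i j. j > i + 1 \<longrightarrow> \<not> sublist [i, j] w"
    "\<forall>v \<in> commutation_class n w. \<forall>i. \<not> sublist [i + 1, i, i + 1] v"
    using ex_normal_reduced_expression[OF assms] by blast
  show ?thesis
  proof (rule ex1I[of _ w], goal_cases)
    case 1
    \<comment> \<open>This makes condition (2) an instance of condition (3).\<close>
    have "w \<in> commutation_class n w"
      using w(1) by (auto simp: commutation_class_def)
    with w show ?case by simp
  next
    case (2 v)
    show ?case
    proof (rule separated_word_perm_inj[where n = n])
      show "separated v" "separated w"
        using 2 w reduced_expression_separated by blast+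
      show "set v \<subseteq> {1..<n}" "set w \<subseteq> {1..<n}" "word_perm v = word_perm w"
        using 2 w(1) by (auto simp: reduced_expression_def expression_def)
    qed (use 2 w(2) in simp_all)
  qed
qed

end
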